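(* The following are equivalent: (1) ODF: there is $C>0$ such that for all $n$ and all $v\in V_n$, $|v|\le C|Pv|$. (2) There exist TCO.
   Context: Setting. $O$ is an infinite dimensional separable real Hilbert space with scalar product $\langle\cdot,\cdot\rangle$ and norm $|\cdot|$. $X\subseteq O$ is a dense subspace, itself a Hilbert space with continuous inclusion $X\to O$. $a$ is a continuous symmetric bilinear form on $X$ with $a(u,u)\ge 0$ for all $u\in X$, such that $\langle\cdot,\cdot\rangle+a$ is coercive on $X$; this form is taken as the scalar product of $X$, so $\|u\|^2=|u|^2+a(u,u)$ is the norm of $X$. Define $W=\{u\in X: a(u,u')=0\ \forall u'\in X\}$ and $V=\{u\in X:\langle u,w\rangle=0\ \forall w\in W\}$, so $X=V\oplus W$; $W$ is closed in $O$ and may be infinite dimensional. $\overline V$ is the closure of $V$ in $O$; it is the $O$-orthogonal complement of $W$. $P$ is the $O$-orthogonal projector in $O$ with range $\overline V$ and kernel $W$. It is assumed that the injection $V\to O$ is compact ($V$ carrying the norm of $X$). Discretization. $(X_n)_{n\in\mathbb N}$ is a sequence of finite dimensional subspaces of $X$ satisfying AS: for all $u\in X$, $\lim_{n\to\infty}\inf_{u'\in X_n}\|u-u'\|=0$. Define $W_n=\{u\in X_n: a(u,u')=0\ \forall u'\in X_n\}=X_n\cap W$ and $V_n=\{u\in X_n:\langle u,w\rangle=0\ \forall w\in W_n\}$, so $X_n=V_n\oplus W_n$ ($V_n$ need not be contained in $V$). Compatible operators. A linear operator $Q_n:X\to X_n$ is compatible with $X_n$ if it maps $W$ into $W_n$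 and $u-Q_nu\in W_n$ for every $u\in X_n$. A sequence $(Q_n)$ is compatible if each $Q_n$ is compatible with $X_n$. TCO (Tame Compatible Operators) are compatible sequences $(Q_n)$ that are uniformly bounded $O\to O$, i.e. there is $C>0$ with $|Q_nu|\le C|u|$ for all $n$ and all $u\in X$ (so that each $Q_n$ extends by density to $O$ with the same bound). *)

theory Defs
  imports "HOL-Analysis.Analysis"
begin

section \<open>Hilbert structures carried by a subspace\<close>

text \<open>
  A subspace \<open>X\<close> of the type \<open>'a\<close> carries a second Hilbert structure, with its own norm. All
  conditions on forms are relative to \<open>X\<close>, so the values of a form outside \<open>X\<close> are irrelevant.
\<close>

definition sym_bilinear_on :: "'a::real_vector set \<Rightarrow> ('a \<Rightarrow> 'a \<Rightarrow> real) \<Rightarrow> bool" where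
  "sym_bilinear_on X b \<longleftrightarrow>
     (\<forall>u\<in>X. \<forall>v\<in>X. b u v = b v u) \<and>
     (\<forall>u\<in>X. \<forall>u'\<in>X. \<forall>v\<in>X. b (u + u') v = b u v + b u' v) \<and>
     (\<forall>c. \<forall>u\<in>X. \<forall>v\<in>X. b (c *\<^sub>R u) v = c * b u v)"

definition form_norm :: "('a \<Rightarrow> 'a \<Rightarrow> real) \<Rightarrow> 'a \<Rightarrow> real" where
  "form_norm b u = sqrt (b u u)"

definition complete_wrt :: "'a::real_vector set \<Rightarrow> ('a \<Rightarrow> real) \<Rightarrow> bool" where
  "complete_wrt X N \<longleftrightarrow>
     (\<forall>s :: nat \<Rightarrow> 'a. (\<forall>n. s n \<in> X) \<longrightarrow>
        (\<forall>e>0. \<exists>M. \<forall>m\<ge>M. \<forall>n\<ge>M. N (s m - s n) < e) \<longrightarrow>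
        (\<exists>l\<in>X. (\<lambda>n. N (s n - l)) \<longlonglongrightarrow> 0))"

definition hilbert_space_on :: "'a::real_vector set \<Rightarrow> ('a \<Rightarrow> 'a \<Rightarrow> real) \<Rightarrow> bool" where
  "hilbert_space_on X ip \<longleftrightarrow>
     subspace X \<and> sym_bilinear_on X ip \<and> (\<forall>u\<in>X. u \<noteq> 0 \<longrightarrow> 0 < ip u u) \<and>
     complete_wrt X (form_norm ip)"

definition finite_dimensional_subspace :: "'a::real_vector set \<Rightarrow> bool" where
  "finite_dimensional_subspace S \<longleftrightarrow> (\<exists>B. finite B \<and> span B = S)"

definition linear_map_on :: "'a::real_vector set \<Rightarrow> ('a \<Rightarrow> 'a) \<Rightarrow> bool" where
  "linear_map_on X f \<longleftrightarrow>
     (\<forall>u\<in>X. \<forall>v\<in>X. f (u + v) = f u + f v) \<and> (\<forall>c. \<forall>u\<in>X. f (c *\<^sub>R u) = c *\<^sub>R f u)"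

text \<open>The norm \<open>\<parallel>u\<parallel>\<close> of \<open>X\<close>, with \<open>\<parallel>u\<parallel>\<^sup>2 = \<bar>u\<bar>\<^sup>2 + a u u\<close>.\<close>

definition energy_norm :: "('a::real_inner \<Rightarrow> 'a \<Rightarrow> real) \<Rightarrow> 'a \<Rightarrow> real" where
  "energy_norm a = form_norm (\<lambda>u v. u \<bullet> v + a u v)"

text \<open>
  Taking \<open>S = X\<close> gives \<open>W\<close> and \<open>V\<close>; taking \<open>S = X\<^sub>n\<close> gives \<open>W\<^sub>n\<close> and \<open>V\<^sub>n\<close>.
\<close>

definition W_of :: "('a::real_inner \<Rightarrow> 'a \<Rightarrow> real) \<Rightarrow> 'a set \<Rightarrow> 'a set" where
  "W_of a S = {u \<in> S. \<forall>u'\<in>S. a u u' = 0}"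

definition V_of :: "('a::real_inner \<Rightarrow> 'a \<Rightarrow> real) \<Rightarrow> 'a set \<Rightarrow> 'a set" where
  "V_of a S = {u \<in> S. \<forall>w\<in>W_of a S. u \<bullet> w = 0}"

text \<open>
  The orthogonal projector onto a closed subspace \<open>S\<close> of a Hilbert space. Its kernel is the
  orthogonal complement of \<open>S\<close>; for \<open>S = closure (V_of a X)\<close> this is \<open>W_of a X\<close>.
\<close>

definition orth_projector :: "'a::real_inner set \<Rightarrow> 'a \<Rightarrow> 'a" where
  "orth_projector S u = (THE p. p \<in> S \<and> u - p \<in> S\<^sup>\<bottom>)"

definition P_of :: "('a::real_inner \<Rightarrow> 'a \<Rightarrow> real) \<Rightarrow> 'a set \<Rightarrow> 'a \<Rightarrow> 'a" where
  "P_of a X = orth_projector (closure (V_of a X))"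


section \<open>The continuous and the discrete setting\<close>

text \<open>
  The type \<open>'a\<close> is the space \<open>O\<close>, and \<open>ip\<close> is the scalar product with which \<open>X\<close> is initially
  given. It serves only to express that \<open>X\<close> is a Hilbert space continuously included in \<open>O\<close> on
  which \<open>a\<close> is continuous and \<open>u \<bullet> v + a u v\<close> is coercive; afterwards \<open>X\<close> is equipped with the
  equivalent norm \<open>energy_norm a\<close>.
\<close>

locale semidefinite_setting =
  fixes X :: "'a::{real_inner, complete_space, second_countable_topology} set"
    and ip :: "'a \<Rightarrow> 'a \<Rightarrow> real"
    and a :: "'a \<Rightarrow> 'a \<Rightarrow> real"
  assumes infinite_dimensional: "\<not> finite_dimensional_subspace (UNIV :: 'a set)"
    and hilbert_X: "hilbert_space_on X ip"
    and dense_X: "closure X = UNIV"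
    and continuous_inclusion: "\<exists>C. \<forall>u\<in>X. norm u \<le> C * form_norm ip u"
    and bilinear_a: "sym_bilinear_on X a"
    and continuous_a: "\<exists>C. \<forall>u\<in>X. \<forall>v\<in>X. \<bar>a u v\<bar> \<le> C * form_norm ip u * form_norm ip v"
    and nonneg_a: "\<forall>u\<in>X. 0 \<le> a u u"
    and coercive: "\<exists>c>0. \<forall>u\<in>X. c * (form_norm ip u)\<^sup>2 \<le> u \<bullet> u + a u u"
    and compact_injection:
      "\<forall>B \<subseteq> V_of a X. (\<exists>K. \<forall>u\<in>B. energy_norm a u \<le> K) \<longrightarrow> compact (closure B)"

locale semidefinite_discretization = semidefinite_setting X ip a
  for X :: "'a::{real_inner, complete_space, second_countable_topology} set"
    and ip a :: "'a \<Rightarrow> 'a \<Rightarrow> real" +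
  fixes Xn :: "nat \<Rightarrow> 'a set"
  assumes finite_dimensional_Xn: "finite_dimensional_subspace (Xn n)"
    and Xn_subset: "Xn n \<subseteq> X"
    and approximating: "\<forall>u\<in>X. (\<lambda>n. INF u'\<in>Xn n. energy_norm a (u - u')) \<longlonglongrightarrow> 0"


section \<open>The two properties\<close>

definition ODF ::
  "'a::real_inner set \<Rightarrow> ('a \<Rightarrow> 'a \<Rightarrow> real) \<Rightarrow> (nat \<Rightarrow> 'a set) \<Rightarrow> bool" where
  "ODF X a Xn \<longleftrightarrow> (\<exists>C>0. \<forall>n. \<forall>v\<in>V_of a (Xn n). norm v \<le> C * norm (P_of a X v))"

definition compatible_operator ::
  "'a::real_inner set \<Rightarrow> ('a \<Rightarrow> 'a \<Rightarrow> real) \<Rightarrow> 'a set \<Rightarrow> ('a \<Rightarrow> 'a) \<Rightarrow> bool" where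
  "compatible_operator X a Y q \<longleftrightarrow>
     linear_map_on X q \<and> q ` X \<subseteq> Y \<and>
     q ` W_of a X \<subseteq> W_of a Y \<and> (\<forall>u\<in>Y. u - q u \<in> W_of a Y)"

definition tame_compatible_operators ::
  "'a::real_inner set \<Rightarrow> ('a \<Rightarrow> 'a \<Rightarrow> real) \<Rightarrow> (nat \<Rightarrow> 'a set) \<Rightarrow> (nat \<Rightarrow> 'a \<Rightarrow> 'a) \<Rightarrow> bool" where
  "tame_compatible_operators X a Xn Q \<longleftrightarrow>
     (\<forall>n. compatible_operator X a (Xn n) (Q n)) \<and>
     (\<exists>C>0. \<forall>n. \<forall>u\<in>X. norm (Q n u) \<le> C * norm u)"

end

theory Submission
  imports Defs
begin

text \<open>
  Every \<open>v \<in> V\<^sub>n\<close> satisfies \<open>v - Pv \<in> W\<close>, so a compatible \<open>Q\<close> gives \<open>v - Q(Pv) \<in> W\<^sub>n\<close>. As \<open>v\<close> is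
  orthogonal to \<open>W\<^sub>n\<close>, this yields \<open>\<bar>v\<bar> \<le> \<bar>Q(Pv)\<bar>\<close>, and tameness of \<open>Q\<close> implies ODF.
  Conversely, ODF makes \<open>P\<close> injective on \<open>V\<^sub>n\<close>, and \<open>Q\<^sub>n u\<close> can be taken to be the \<open>v \<in> V\<^sub>n\<close> for
  which \<open>Pv\<close> is the orthogonal projection of \<open>Pu\<close> onto \<open>P(V\<^sub>n)\<close>, so that
  \<open>\<bar>Q\<^sub>n u\<bar> \<le> C \<bar>Pv\<bar> \<le> C \<bar>Pu\<bar> \<le> C \<bar>u\<bar>\<close>.
\<close>

section \<open>Orthogonal projections in inner product spaces\<close>

text \<open>Near \<open>t = 0\<close> the linear term dominates, so a nonzero \<open>b\<close> would
  give negative values for small \<open>t\<close> of the opposite sign. This first-variation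
  argument serves both minimizers of the distance and null vectors of a form.\<close>

lemma linear_coeff_zero_if_quadratic_nonneg:
  fixes b c :: real
  assumes "\<And>t. 0 \<le> t * b + t\<^sup>2 * c"
  shows "b = 0"
proof (rule ccontr)
  assume "b \<noteq> 0"
  \<comment> \<open>\<open>t = - b / k\<close> is small enough once \<open>k\<close> exceeds
    \<open>c\<close>; the added 1 makes \<open>k > c\<close> strict and keeps \<open>k\<close>
    positive when \<open>c = 0\<close>.\<close>
  define k where "k = \<bar>c\<bar> + 1"
  have k: "k > 0" "c < k" by (auto simp: k_def)
  have "(- b / k) * b + (- b / k)\<^sup>2 * c = b\<^sup>2 * (c - k) / k\<^sup>2"
    using k by (simp add: field_simps power2_eq_square)
  also have "\<dots> < 0"
    using k \<open>b \<noteq> 0\<close> by (intro divide_neg_pos mult_pos_neg) auto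
  finally show False using assms[of "- b / k"] by simp
qed

text \<open>A minimizing sequence for the distance to \<open>S\<close> is Cauchy by the
  parallelogram law, its limit attains the distance, and the first variation there gives
  orthogonality. It is applied to \<open>W\<close>, which may be infinite dimensional.\<close>

lemma orthogonal_projection_exists:
  fixes S :: "'a::{real_inner, complete_space} set"
  assumes S: "subspace S" and "closed S"
  obtains p where "p \<in> S" "\<And>s. s \<in> S \<Longrightarrow> (u - p) \<bullet> s = 0"
proof -
  define d where "d = (INF s\<in>S. (norm (u - s))\<^sup>2)"
  have ne: "S \<noteq> {}" using subspace_0[OF S] by auto
  have bdd: "bdd_below ((\<lambda>s. (norm (u - s))\<^sup>2) ` S)"
    by (rule bdd_belowI[where m=0]) auto
  have d_le: "d \<le> (norm (u - s))\<^sup>2" if "s \<in> S" for s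
    unfolding d_def by (rule cINF_lower[OF bdd that])
  have "\<exists>s\<in>S. (norm (u - s))\<^sup>2 < d + 1 / real (Suc n)" for n
    using cINF_less_iff[OF ne bdd, of "d + 1 / real (Suc n)"] by (simp add: d_def)
  then obtain s where s: "\<And>n. s n \<in> S" "\<And>n. (norm (u - s n))\<^sup>2 < d + 1 / real (Suc n)"
    by metis
  have dist: "(dist (s m) (s n))\<^sup>2 \<le> 4 / real (Suc N)" if "m \<ge> N" "n \<ge> N" for m n N
  proof -
    \<comment> \<open>The midpoint lies in \<open>S\<close>, so its squared distance to
      \<open>u\<close> is at least \<open>d\<close>. In the parallelogram identity the multiples of
      \<open>d\<close> then cancel, and only the four errors of size \<open>1 / Suc N\<close>
      remain.\<close>
    define h where "h = (1/2) *\<^sub>R (s m + s n)"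
    have "h \<in> S" unfolding h_def using S s by (intro subspace_scale subspace_add)
    then have "d \<le> (norm (u - h))\<^sup>2" by (rule d_le)
    moreover have "(norm (s m - s n))\<^sup>2
        = 2 * (norm (u - s m))\<^sup>2 + 2 * (norm (u - s n))\<^sup>2 - 4 * (norm (u - h))\<^sup>2"
      unfolding h_def power2_norm_eq_inner by (simp add: algebra_simps inner_commute)
    moreover have "1 / real (Suc m) \<le> 1 / real (Suc N)" "1 / real (Suc n) \<le> 1 / real (Suc N)"
      using that by (auto intro!: divide_left_mono)
    ultimately show ?thesis
      using s(2)[of m] s(2)[of n] unfolding dist_norm by linarith
  qed
  have "Cauchy s"
  proof (rule metric_CauchyI)
    fix e :: real assume "e > 0"
    obtain N where "4 / e\<^sup>2 < real N"
      using reals_Archimedean2 by blast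
    then have N: "4 / e\<^sup>2 < real (Suc N)" by simp
    then have "4 / real (Suc N) < e\<^sup>2"
      using \<open>e > 0\<close> by (simp add: field_simps del: of_nat_Suc)
    then have "dist (s m) (s n) < e" if "m \<ge> N" "n \<ge> N" for m n
      using dist[OF that] \<open>e > 0\<close> by (intro power2_less_imp_less[of _ e]) auto
    then show "\<exists>M. \<forall>m\<ge>M. \<forall>n\<ge>M. dist (s m) (s n) < e" by blast
  qed
  then obtain p where p: "s \<longlonglongrightarrow> p" using Cauchy_convergent_iff convergent_def by blast
  have pS: "p \<in> S" using closed_sequentially[OF \<open>closed S\<close>] s(1) p by blast
  have "(\<lambda>n. (norm (u - s n))\<^sup>2) \<longlonglongrightarrow> (norm (u - p))\<^sup>2"
    by (intro tendsto_intros p)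
  moreover have "(\<lambda>n. d + 1 / real (Suc n)) \<longlonglongrightarrow> d + 0"
    by (intro tendsto_intros LIMSEQ_Suc lim_1_over_n)
  ultimately have "(norm (u - p))\<^sup>2 \<le> d + 0"
    by (rule LIMSEQ_le) (use s(2) in \<open>auto intro: less_imp_le\<close>)
  then have pd: "(norm (u - p))\<^sup>2 \<le> d" by simp
  have "(u - p) \<bullet> z = 0" if z: "z \<in> S" for z
  proof -
    have "0 \<le> t * (- 2 * ((u - p) \<bullet> z)) + t\<^sup>2 * (z \<bullet> z)" for t
    proof -
      have "(norm (u - p))\<^sup>2 \<le> (norm (u - (p + t *\<^sub>R z)))\<^sup>2"
        using pd d_le[of "p + t *\<^sub>R z"] subspace_add[OF S pS subspace_scale[OF S z]]
        by (meson order_trans)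
      then show ?thesis
        unfolding power2_norm_eq_inner by (simp add: algebra_simps inner_commute power2_eq_square)
    qed
    from linear_coeff_zero_if_quadratic_nonneg[OF this] show ?thesis by simp
  qed
  with pS show thesis by (rule that)
qed

lemma orthogonal_projection_span_finite_exists:
  fixes B :: "'a::real_inner set"
  assumes "finite B"
  obtains p where "p \<in> span B" "\<And>s. s \<in> span B \<Longrightarrow> (u - p) \<bullet> s = 0"
proof -
  obtain C where C: "finite C" "span C = span B" "pairwise orthogonal C"
    using basis_orthogonal[OF assms] by blast
  \<comment> \<open>Fourier expansion in an orthogonal spanning set. A zero vector in
    \<open>C\<close> does no harm: its coefficient is \<open>0 / 0 = 0\<close>, and
    \<open>0 \<bullet> u = 0\<close> as well.\<close>
  define p where "p = (\<Sum>c\<in>C. (c \<bullet> u / (c \<bullet> c)) *\<^sub>R c)"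
  have "p \<in> span B"
    unfolding p_def C(2)[symmetric] by (intro span_sum span_scale span_base)
  moreover have "(u - p) \<bullet> s = 0" if "s \<in> span B" for s
  proof -
    have "orthogonal (u - p) x" if "x \<in> C" for x
    proof -
      have "p \<bullet> x = (\<Sum>c\<in>C. if c = x then c \<bullet> u else 0)"
        unfolding p_def inner_sum_left
        by (rule sum.cong[OF refl])
          (use C(3) that in \<open>auto simp: pairwise_def orthogonal_def\<close>)
      then show ?thesis
        using C(1) that by (simp add: orthogonal_def inner_diff_left inner_commute[of x u])
    qed
    then have "orthogonal (u - p) s"
      using that C(2) by (intro orthogonal_to_span[of s C]) auto
    then show ?thesis by (simp add: orthogonal_def)
  qed
  ultimately show thesis by (rule that)
qed

section \<open>Subspaces, finite dimension and closure\<close>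

lemma subspace_if_finite_dimensional: "finite_dimensional_subspace S \<Longrightarrow> subspace S"
  unfolding finite_dimensional_subspace_def using subspace_span by blast

lemma finite_dimensional_subspace_subset:
  assumes "finite_dimensional_subspace S" "subspace T" "T \<subseteq> S"
  shows "finite_dimensional_subspace T"
proof -
  obtain B where B: "finite B" "span B = S"
    using assms(1) by (auto simp: finite_dimensional_subspace_def)
  obtain D where D: "D \<subseteq> T" "independent D" "T \<subseteq> span D"
    by (meson maximal_independent_subset)
  have "finite D"
    using independent_span_bound[OF B(1) D(2)] D(1) assms(3) B(2) by blast
  moreover have "span D = T"
    using D assms(2) by (meson span_minimal subset_antisym)
  ultimately show ?thesis by (auto simp: finite_dimensional_subspace_def)
qed

lemma closure_subspace:
  fixes S :: "'a::real_normed_vector set"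
  assumes S: "subspace S"
  shows "subspace (closure S)"
proof (rule subspaceI)
  show "0 \<in> closure S" using subspace_0[OF S] closure_subset by blast
next
  fix x y assume "x \<in> closure S" "y \<in> closure S"
  then obtain f g where "\<And>n. f n \<in> S" "\<And>n. g n \<in> S" "f \<longlonglongrightarrow> x" "g \<longlonglongrightarrow> y"
    unfolding closure_sequential by blast
  then show "x + y \<in> closure S"
    unfolding closure_sequential
    by (intro exI[of _ "\<lambda>n. f n + g n"]) (auto intro!: tendsto_add subspace_add[OF S])
next
  fix c x assume "x \<in> closure S"
  then obtain f where "\<And>n. f n \<in> S" "f \<longlonglongrightarrow> x"
    unfolding closure_sequential by blast
  then show "c *\<^sub>R x \<in> closure S"
    unfolding closure_sequential
    by (intro exI[of _ "\<lambda>n. c *\<^sub>R f n"]) (auto intro!: tendsto_intros subspace_scale[OF S])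
qed

section \<open>Forms on a subspace and characterization of the projector\<close>

lemma sym_bilinear_onD:
  assumes "sym_bilinear_on X b" "u \<in> X" "v \<in> X"
  shows "b u v = b v u" "w \<in> X \<Longrightarrow> b (u + w) v = b u v + b w v" "b (c *\<^sub>R u) v = c * b u v"
  using assms by (auto simp: sym_bilinear_on_def)

lemma sym_bilinear_on_subset: "sym_bilinear_on X b \<Longrightarrow> S \<subseteq> X \<Longrightarrow> sym_bilinear_on S b"
  unfolding sym_bilinear_on_def by blast

lemma subspace_W_of:
  assumes S: "subspace S" and b: "sym_bilinear_on S b"
  shows "subspace (W_of b S)"
proof (rule subspaceI)
  show "0 \<in> W_of b S"
    using sym_bilinear_onD(3)[OF b, of 0 _ 0] subspace_0[OF S] by (auto simp: W_of_def)
qed (use sym_bilinear_onD[OF b] S in \<open>auto simp: W_of_def intro: subspace_add subspace_scale\<close>)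

lemma subspace_V_of:
  assumes S: "subspace S"
  shows "subspace (V_of b S)"
  by (rule subspaceI)
    (use S in \<open>auto simp: V_of_def inner_add_left intro: subspace_0 subspace_add subspace_scale\<close>)

text \<open>The value of the form at \<open>u + t *\<^sub>R v\<close> has no constant term, so its
  nonnegativity for all \<open>t\<close> forces the linear coefficient \<open>2 * b u v\<close> to
  vanish. This is what places the discrete kernel \<open>W_of a Y\<close> inside
  \<open>W\<close>.\<close>

lemma nonneg_form_null_vector:
  assumes S: "subspace S" and b: "sym_bilinear_on S b" and nonneg: "\<And>u. u \<in> S \<Longrightarrow> 0 \<le> b u u"
    and u: "u \<in> S" "b u u = 0" and v: "v \<in> S"
  shows "b u v = 0"
proof -
  have "0 \<le> t * (2 * b u v) + t\<^sup>2 * b v v" for t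
  proof -
    have tv: "t *\<^sub>R v \<in> S" "u + t *\<^sub>R v \<in> S" using S u v by (auto intro: subspace_add subspace_scale)
    have "b (u + t *\<^sub>R v) (u + t *\<^sub>R v) = b u (u + t *\<^sub>R v) + t * b v (u + t *\<^sub>R v)"
      using sym_bilinear_onD[OF b] tv u v by simp
    moreover have "b u (u + t *\<^sub>R v) = t * b u v"
      using sym_bilinear_onD(1)[OF b u(1) tv(2)] sym_bilinear_onD(2)[OF b u(1) u(1) tv(1)]
        sym_bilinear_onD(3)[OF b v u(1)] sym_bilinear_onD(1)[OF b u(1) v] u(2) by simp
    moreover have "b v (u + t *\<^sub>R v) = b u v + t * b v v"
      using sym_bilinear_onD(1)[OF b v tv(2)] sym_bilinear_onD(2)[OF b u(1) v tv(1)]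
        sym_bilinear_onD(3)[OF b v v] by simp
    ultimately show ?thesis
      using nonneg[OF tv(2)] by (simp add: algebra_simps power2_eq_square)
  qed
  from linear_coeff_zero_if_quadratic_nonneg[OF this] show ?thesis by simp
qed

text \<open>The difference of two candidates lies in \<open>S\<close> and is orthogonal to
  \<open>S\<close>, hence is zero; this makes the definite description usable.\<close>

lemma orth_projector_eqI:
  assumes S: "subspace S" and p: "p \<in> S" "u - p \<in> S\<^sup>\<bottom>"
  shows "orth_projector S u = p"
  unfolding orth_projector_def
proof (rule the_equality)
  fix q assume q: "q \<in> S \<and> u - q \<in> S\<^sup>\<bottom>"
  have "q - p \<in> S" using q p S by (auto intro: subspace_diff)
  then have "(q - p) \<bullet> (u - p) = 0" "(q - p) \<bullet> (u - q) = 0"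
    using q p by (auto simp: orthogonal_comp_def orthogonal_def)
  then have "(q - p) \<bullet> (q - p) = 0" by (simp add: inner_diff_right)
  then show "q = p" by simp
qed (use p in simp)

lemma closure_orthogonal_compI:
  assumes "\<And>v. v \<in> V \<Longrightarrow> v \<bullet> w = 0"
  shows "w \<in> (closure V)\<^sup>\<bottom>"
proof -
  have "closure V \<subseteq> {x. x \<bullet> w = 0}"
    by (rule closure_minimal)
      (use assms in \<open>auto intro!: closed_Collect_eq continuous_intros\<close>)
  then show ?thesis by (auto simp: orthogonal_comp_def orthogonal_def)
qed

section \<open>The kernel \<open>W\<close> and the projector \<open>P\<close> on
  \<open>X\<close>\<close>

context semidefinite_setting
begin

abbreviation "W \<equiv> W_of a X"
abbreviation "V \<equiv> V_of a X"
abbreviation "P \<equiv> P_of a X"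

lemma subspace_X: "subspace X"
  using hilbert_X by (simp add: hilbert_space_on_def)

lemma form_norm_ip_nonneg: "u \<in> X \<Longrightarrow> 0 \<le> form_norm ip u"
proof -
  assume u: "u \<in> X"
  have b: "sym_bilinear_on X ip" using hilbert_X by (simp add: hilbert_space_on_def)
  have "0 \<le> ip u u"
  proof (cases "u = 0")
    case True
    then show ?thesis using sym_bilinear_onD(3)[OF b u u, of 0] by simp
  next
    case False
    then show ?thesis using hilbert_X u by (auto simp: hilbert_space_on_def less_imp_le)
  qed
  then show ?thesis by (simp add: form_norm_def)
qed

text \<open>On \<open>W\<close> the form \<open>a\<close> vanishes, so coercivity bounds the norm of
  \<open>X\<close> by that of \<open>O\<close>. A sequence in \<open>W\<close> converging in
  \<open>O\<close> is therefore Cauchy in \<open>X\<close>; completeness gives a limit there, the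
  continuous inclusion identifies the two limits, and continuity of \<open>a\<close> carries the
  kernel condition over.\<close>

lemma closed_W: "closed W"
  unfolding closed_sequential_limits
proof (intro allI impI, elim conjE)
  fix s l assume sW: "\<forall>n. s n \<in> W" and l: "s \<longlonglongrightarrow> l"
  have sX: "s n \<in> X" for n using sW by (simp add: W_of_def)
  obtain c where c: "c > 0" "\<And>u. u \<in> X \<Longrightarrow> c * (form_norm ip u)\<^sup>2 \<le> u \<bullet> u + a u u"
    using coercive by blast
  have bound: "form_norm ip u \<le> norm u / sqrt c" if "u \<in> W" for u
  proof -
    have "c * (form_norm ip u)\<^sup>2 \<le> (norm u)\<^sup>2"
      using c(2)[of u] that by (simp add: W_of_def power2_norm_eq_inner)
    then have "(form_norm ip u)\<^sup>2 \<le> (norm u / sqrt c)\<^sup>2"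
      using c(1) by (simp add: field_simps power_divide)
    then show ?thesis by (rule power2_le_imp_le) (use c(1) in simp)
  qed
  have "\<exists>M. \<forall>m\<ge>M. \<forall>n\<ge>M. form_norm ip (s m - s n) < e" if "e > 0" for e
  proof -
    have "Cauchy s" using l by (rule LIMSEQ_imp_Cauchy)
    moreover have "e * sqrt c > 0" using that c(1) by simp
    ultimately obtain M where M: "\<forall>m\<ge>M. \<forall>n\<ge>M. norm (s m - s n) < e * sqrt c"
      unfolding Cauchy_def dist_norm by blast
    have "form_norm ip (s m - s n) < e" if "m \<ge> M" "n \<ge> M" for m n
    proof -
      have "s m - s n \<in> W"
        using sW subspace_W_of[OF subspace_X bilinear_a] by (auto intro: subspace_diff)
      then have "form_norm ip (s m - s n) \<le> norm (s m - s n) / sqrt c" by (rule bound)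
      also have "\<dots> < e" using M that c(1) by (simp add: field_simps)
      finally show ?thesis .
    qed
    then show ?thesis by blast
  qed
  then obtain l' where l': "l' \<in> X" "(\<lambda>n. form_norm ip (s n - l')) \<longlonglongrightarrow> 0"
    using hilbert_X sX unfolding hilbert_space_on_def complete_wrt_def by blast
  have dX: "s n - l' \<in> X" for n using sX l' subspace_X by (auto intro: subspace_diff)
  obtain C where C: "\<And>u. u \<in> X \<Longrightarrow> norm u \<le> C * form_norm ip u"
    using continuous_inclusion by blast
  have "(\<lambda>n. C * form_norm ip (s n - l')) \<longlonglongrightarrow> 0"
    using tendsto_mult_right_zero[OF l'(2)] by simp
  then have "(\<lambda>n. norm (s n - l')) \<longlonglongrightarrow> 0"
    by (rule tendsto_sandwich[OF _ _ tendsto_const, rotated 2]) (use C dX in auto)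
  then have "s \<longlonglongrightarrow> l'" by (rule LIM_zero_cancel[OF tendsto_norm_zero_cancel])
  with l have ll: "l' = l" by (rule LIMSEQ_unique[rotated])
  obtain K where K: "\<And>u v. u \<in> X \<Longrightarrow> v \<in> X \<Longrightarrow> \<bar>a u v\<bar> \<le> K * form_norm ip u * form_norm ip v"
    using continuous_a by blast
  have "a l u = 0" if u: "u \<in> X" for u
  proof -
    \<comment> \<open>The left side is 0 because \<open>s n\<close> is in \<open>W\<close>, so
      \<open>a l u\<close> is up to sign \<open>a (s n - l) u\<close>, which tends to 0.\<close>
    have "a (s n) u = a (s n - l') u + a l' u" for n
      using sym_bilinear_onD(2)[OF bilinear_a dX u l'(1)] by simp
    then have "\<bar>a l u\<bar> \<le> K * form_norm ip (s n - l') * form_norm ip u" for n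
      using K[OF dX u, of n] sW u by (simp add: W_of_def ll)
         (smt (verit))
    moreover have "(\<lambda>n. K * form_norm ip (s n - l') * form_norm ip u) \<longlonglongrightarrow> K * 0 * form_norm ip u"
      by (intro tendsto_intros l')
    ultimately have "\<bar>a l u\<bar> \<le> K * 0 * form_norm ip u"
      by (intro LIMSEQ_le_const) auto
    then show ?thesis by simp
  qed
  then show "l \<in> W" using l'(1) ll by (simp add: W_of_def)
qed

text \<open>\<open>W\<close> is orthogonal to \<open>V\<close>, hence to its closure, so any
  splitting along \<open>V\<close> and \<open>W\<close> is the projection. Linearity of
  \<open>P\<close> on \<open>X\<close> is read off from this criterion.\<close>

lemma P_eqI:
  assumes "v \<in> V" "u - v \<in> W"
  shows "P u = v"
  unfolding P_of_def
proof (rule orth_projector_eqI)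
  show "subspace (closure V)"
    by (intro closure_subspace subspace_V_of subspace_X)
  show "v \<in> closure V" using assms(1) closure_subset by blast
  show "u - v \<in> (closure V)\<^sup>\<bottom>"
    by (rule closure_orthogonal_compI) (use assms(2) in \<open>simp add: V_of_def\<close>)
qed

text \<open>Projecting \<open>u\<close> onto the closed space \<open>W\<close> stays inside
  \<open>X\<close>, so the remainder is in \<open>X\<close> too and belongs to \<open>V\<close>
  itself, not merely to its closure. Thus \<open>P\<close> maps \<open>X\<close> into
  \<open>X\<close>, where compatible operators are controlled.\<close>

lemma P_decomp:
  assumes u: "u \<in> X"
  shows "P u \<in> V" "u - P u \<in> W"
proof -
  obtain w where w: "w \<in> W" "\<And>s. s \<in> W \<Longrightarrow> (u - w) \<bullet> s = 0"
    using orthogonal_projection_exists[OF subspace_W_of[OF subspace_X bilinear_a] closed_W] by blast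
  have "w \<in> X" using w(1) by (simp add: W_of_def)
  then have "u - w \<in> V" using w u subspace_X by (auto simp: V_of_def intro: subspace_diff)
  moreover have "P u = u - w" by (rule P_eqI) (use w calculation in auto)
  ultimately show "P u \<in> V" "u - P u \<in> W" using w by auto
qed

lemma P_add: "u \<in> X \<Longrightarrow> v \<in> X \<Longrightarrow> P (u + v) = P u + P v"
  by (rule P_eqI)
    (use P_decomp[of u] P_decomp[of v] subspace_V_of[OF subspace_X]
       subspace_W_of[OF subspace_X bilinear_a] subspace_add[of W "u - P u" "v - P v"]
     in \<open>auto intro: subspace_add simp: algebra_simps\<close>)

lemma P_scale: "u \<in> X \<Longrightarrow> P (c *\<^sub>R u) = c *\<^sub>R P u"
  by (rule P_eqI)
    (use P_decomp[of u] subspace_V_of[OF subspace_X]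
       subspace_W_of[OF subspace_X bilinear_a] subspace_scale[of W "u - P u" c]
     in \<open>auto intro: subspace_scale simp: algebra_simps\<close>)

lemma P_W: "w \<in> W \<Longrightarrow> P w = 0"
  by (rule P_eqI) (auto simp: subspace_0 subspace_V_of subspace_X)

lemma P_0: "P 0 = 0"
  by (intro P_W subspace_0 subspace_W_of subspace_X bilinear_a)

lemma norm_P_le:
  assumes "u \<in> X"
  shows "norm (P u) \<le> norm u"
proof -
  have "P u \<bullet> (u - P u) = 0" using P_decomp[OF assms] by (simp add: V_of_def)
  then have "(norm (P u))\<^sup>2 = P u \<bullet> u" by (simp add: power2_norm_eq_inner inner_diff_right)
  also have "\<dots> \<le> norm (P u) * norm u" by (rule norm_cauchy_schwarz)
  finally show ?thesis by (cases "P u = 0") (simp_all add: power2_eq_square)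
qed

section \<open>Compatible operators for a single subspace \<open>Y\<close>\<close>

lemma norm_le_norm_compatible_P:
  assumes q: "compatible_operator X a Y q" and Y: "Y \<subseteq> X" "subspace Y" and v: "v \<in> V_of a Y"
  shows "norm v \<le> norm (q (P v))"
proof -
  have vY: "v \<in> Y" using v by (simp add: V_of_def)
  then have vX: "v \<in> X" using Y by blast
  note d = P_decomp[OF vX]
  have X: "P v \<in> X" "v - P v \<in> X" using d by (auto simp: V_of_def W_of_def)
  have lin: "q (P v + (v - P v)) = q (P v) + q (v - P v)"
    using q X unfolding compatible_operator_def linear_map_on_def by blast
  \<comment> \<open>The two summands use the two halves of compatibility: \<open>v\<close> is in
    \<open>Y\<close>, and \<open>v - P v\<close> is in \<open>W\<close>.\<close>
  have "v - q (P v) = (v - q v) + q (v - P v)" using lin by simp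
  moreover have "v - q v \<in> W_of a Y" "q (v - P v) \<in> W_of a Y"
    using q vY d unfolding compatible_operator_def by blast+
  ultimately have "v - q (P v) \<in> W_of a Y"
    using subspace_W_of[OF Y(2) sym_bilinear_on_subset[OF bilinear_a Y(1)]]
    by (metis subspace_add)
  then have "v \<bullet> (v - q (P v)) = 0" using v by (simp add: V_of_def)
  then have "norm v * norm v = v \<bullet> q (P v)"
    by (simp add: power2_norm_eq_inner[symmetric] power2_eq_square[symmetric] inner_diff_right)
  also have "\<dots> \<le> norm v * norm (q (P v))" by (rule norm_cauchy_schwarz)
  finally show ?thesis by (cases "v = 0") simp_all
qed

text \<open>The operator inherits the constant \<open>C\<close> of the hypothesis, so a bound that
  is uniform over a family of subspaces stays uniform for the operators.\<close>

lemma compatible_operator_exists: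
  assumes Y: "Y \<subseteq> X" "finite_dimensional_subspace Y"
    and odf: "\<And>v. v \<in> V_of a Y \<Longrightarrow> norm v \<le> C * norm (P v)" and C: "C > 0"
  shows "\<exists>q. compatible_operator X a Y q \<and> (\<forall>u\<in>X. norm (q u) \<le> C * norm u)"
proof -
  let ?V = "V_of a Y" and ?W = "W_of a Y"
  have subY: "subspace Y" using Y(2) by (rule subspace_if_finite_dimensional)
  have bilY: "sym_bilinear_on Y a" by (rule sym_bilinear_on_subset[OF bilinear_a Y(1)])
  have subV: "subspace ?V" and subW: "subspace ?W"
    by (rule subspace_V_of[OF subY], rule subspace_W_of[OF subY bilY])
  have VY: "?V \<subseteq> Y" and WY: "?W \<subseteq> Y" by (auto simp: V_of_def W_of_def)
  have VX: "v \<in> X" if "v \<in> ?V" for v using that VY Y by blast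
  \<comment> \<open>Testing a discrete kernel vector \<open>u\<close> against itself gives
    \<open>a u u = 0\<close>, which suffices for a nonnegative form.\<close>
  have WW: "?W \<subseteq> W"
    using nonneg_form_null_vector[OF subspace_X bilinear_a] nonneg_a Y(1)
    by (auto simp: W_of_def)
  obtain BV where BV: "finite BV" "span BV = ?V"
    using finite_dimensional_subspace_subset[OF Y(2) subV VY]
    by (auto simp: finite_dimensional_subspace_def)
  obtain BW where BW: "finite BW" "span BW = ?W"
    using finite_dimensional_subspace_subset[OF Y(2) subW WY]
    by (auto simp: finite_dimensional_subspace_def)
  define is_q where "is_q u v \<longleftrightarrow> v \<in> ?V \<and> (\<forall>v'\<in>?V. (P u - P v) \<bullet> P v' = 0)" for u v
  have ex: "\<exists>v. is_q u v" for u
  proof -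
    have "subspace (P ` ?V)"
    proof (rule subspaceI)
      show "0 \<in> P ` ?V" using P_0 subspace_0[OF subV] by force
      show "x + y \<in> P ` ?V" if "x \<in> P ` ?V" "y \<in> P ` ?V" for x y
        using that VX subspace_add[OF subV] by (force simp flip: P_add)
      show "c *\<^sub>R x \<in> P ` ?V" if "x \<in> P ` ?V" for c x
        using that VX subspace_scale[OF subV] by (force simp flip: P_scale)
    qed
    moreover have "P ` ?V \<subseteq> span (P ` BV)"
    proof -
      \<comment> \<open>\<open>P\<close> is shown to be linear only on \<open>X\<close>, so the
        image of the span is handled by a subspace of \<open>?V\<close> that contains the generators
        \<open>BV\<close>.\<close>
      let ?T = "{v \<in> ?V. P v \<in> span (P ` BV)}"
      have "subspace ?T"
      proof (rule subspaceI)
        show "0 \<in> ?T" using P_0 subspace_0[OF subV] by (simp add: span_zero)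
        show "x + y \<in> ?T" if "x \<in> ?T" "y \<in> ?T" for x y
          using that P_add VX by (auto intro: subspace_add[OF subV] span_add)
        show "c *\<^sub>R x \<in> ?T" if "x \<in> ?T" for c x
          using that P_scale VX by (auto intro: subspace_scale[OF subV] span_scale)
      qed
      moreover have "BV \<subseteq> ?T" using BV(2) span_superset by (auto intro: span_base)
      ultimately have "span BV \<subseteq> ?T" by (rule span_minimal[rotated])
      then show ?thesis by (auto simp: BV)
    qed
    ultimately have "span (P ` BV) = P ` ?V"
      using BV(2) by (metis image_mono span_minimal span_superset subset_antisym)
    then obtain p where "p \<in> P ` ?V" "\<And>s. s \<in> P ` ?V \<Longrightarrow> (P u - p) \<bullet> s = 0"
      using orthogonal_projection_span_finite_exists[OF finite_imageI[OF BV(1)], of P "P u"] by metis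
    then show ?thesis by (auto simp: is_q_def)
  qed
  have uniq: "v = v'" if "is_q u v" "is_q u v'" for u v v'
  proof -
    define z where "z = v - v'"
    have z: "z \<in> ?V" using that subV by (auto simp: is_q_def z_def intro: subspace_diff)
    have "P v = P z + P v'"
      using P_add[of z v'] VX z that by (simp add: z_def is_q_def)
    moreover have "(P u - P v) \<bullet> P z = 0" "(P u - P v') \<bullet> P z = 0"
      using that z by (auto simp: is_q_def)
    \<comment> \<open>Subtracting the two normal equations tested with \<open>z\<close>; the
      hypothesis \<open>odf\<close> then turns \<open>P z = 0\<close> into
      \<open>z = 0\<close>.\<close>
    ultimately have "P z \<bullet> P z = 0" by (simp add: inner_diff_left inner_add_left)
    then have "norm z \<le> 0" using odf[OF z] by simp
    then show ?thesis by (simp add: z_def)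
  qed
  obtain q where q: "\<And>u. is_q u (q u)" using ex by metis
  have q_eqI: "q u = v" if "is_q u v" for u v using uniq[OF q that] .
  have qV: "q u \<in> ?V" for u using q[of u] by (simp add: is_q_def)
  have q_add: "q (u + v) = q u + q v" if "u \<in> X" "v \<in> X" for u v
  proof (rule q_eqI)
    have "P (u + v) - P (q u + q v) = (P u - P (q u)) + (P v - P (q v))"
      using P_add that VX qV by simp
    then show "is_q (u + v) (q u + q v)"
      using q[of u] q[of v] subspace_add[OF subV] by (simp add: is_q_def inner_add_left)
  qed
  have q_scale: "q (c *\<^sub>R u) = c *\<^sub>R q u" if "u \<in> X" for c u
  proof (rule q_eqI)
    have "P (c *\<^sub>R u) - P (c *\<^sub>R q u) = c *\<^sub>R (P u - P (q u))"
      using P_scale that VX qV by (simp add: scaleR_diff_right)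
    then show "is_q (c *\<^sub>R u) (c *\<^sub>R q u)"
      using q[of u] subspace_scale[OF subV] by (simp add: is_q_def)
  qed
  have "q w = 0" if "w \<in> W" for w
    by (rule q_eqI) (use P_W that P_0 subspace_0[OF subV] in \<open>simp add: is_q_def\<close>)
  then have qW: "q ` W \<subseteq> ?W" using subspace_0[OF subW] by auto
  have q_id: "u - q u \<in> ?W" if u: "u \<in> Y" for u
  proof -
    \<comment> \<open>This splits \<open>u\<close> along \<open>?V\<close> and \<open>?W\<close>.
      Since \<open>P\<close> kills \<open>w\<close>, the component \<open>u - w\<close> solves the
      normal equations with zero residual, so it equals \<open>q u\<close>.\<close>
    obtain w where w: "w \<in> ?W" "\<And>s. s \<in> ?W \<Longrightarrow> (u - w) \<bullet> s = 0"
      using orthogonal_projection_span_finite_exists[OF BW(1)] BW(2) by metis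
    have v: "u - w \<in> ?V" using w u WY subY by (auto simp: V_of_def intro: subspace_diff)
    have "P u = P (u - w)"
      using P_add[of "u - w" w] VX[OF v] P_W w(1) WW by (auto simp: W_of_def)
    then have "q u = u - w" by (intro q_eqI) (simp add: is_q_def v)
    then show ?thesis using w by simp
  qed
  have q_bound: "norm (q u) \<le> C * norm u" if u: "u \<in> X" for u
  proof -
    have "(P u - P (q u)) \<bullet> P (q u) = 0" using q[of u] by (simp add: is_q_def)
    then have "norm (P (q u)) * norm (P (q u)) = P u \<bullet> P (q u)"
      by (simp add: power2_norm_eq_inner[symmetric] power2_eq_square[symmetric] inner_diff_left)
    also have "\<dots> \<le> norm (P u) * norm (P (q u))" by (rule norm_cauchy_schwarz)
    finally have "norm (P (q u)) \<le> norm (P u)" by (cases "P (q u) = 0") simp_all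
    also have "\<dots> \<le> norm u" by (rule norm_P_le[OF u])
    finally have "C * norm (P (q u)) \<le> C * norm u" using C by simp
    with odf[OF qV] show ?thesis by (rule order_trans)
  qed
  have "compatible_operator X a Y q"
    unfolding compatible_operator_def linear_map_on_def
    using q_add q_scale qV VY qW q_id by blast
  with q_bound show ?thesis by blast
qed

end

theorem proposition17:
  fixes X :: "'a::{real_inner, complete_space, second_countable_topology} set"
    and ip a :: "'a \<Rightarrow> 'a \<Rightarrow> real"
    and Xn :: "nat \<Rightarrow> 'a set"
  assumes "semidefinite_discretization X ip a Xn"
  shows "ODF X a Xn \<longleftrightarrow> (\<exists>Q. tame_compatible_operators X a Xn Q)"
proof
  interpret semidefinite_discretization X ip a Xn by fact
  {
    assume "ODF X a Xn"
    then obtain C where C: "C > 0" "\<And>n v. v \<in> V_of a (Xn n) \<Longrightarrow> norm v \<le> C * norm (P v)"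
      unfolding ODF_def by blast
    have "\<exists>q. compatible_operator X a (Xn n) q \<and> (\<forall>u\<in>X. norm (q u) \<le> C * norm u)" for n
      using Xn_subset finite_dimensional_Xn C(2) C(1) by (rule compatible_operator_exists)
    then show "\<exists>Q. tame_compatible_operators X a Xn Q"
      unfolding tame_compatible_operators_def using C(1) by metis
  }
  {
    assume "\<exists>Q. tame_compatible_operators X a Xn Q"
    then obtain Q C where Q: "\<And>n. compatible_operator X a (Xn n) (Q n)"
      and C: "C > 0" "\<And>n u. u \<in> X \<Longrightarrow> norm (Q n u) \<le> C * norm u"
      unfolding tame_compatible_operators_def by blast
    have "norm v \<le> C * norm (P v)" if v: "v \<in> V_of a (Xn n)" for n v
    proof -
      have sub: "subspace (Xn n)"
        using finite_dimensional_Xn[of n] by (rule subspace_if_finite_dimensional)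
      have "v \<in> X" using v Xn_subset by (auto simp: V_of_def)
      \<comment> \<open>The bound on \<open>Q n\<close> is available only for arguments in
        \<open>X\<close>.\<close>
      then have "P v \<in> X" using P_decomp(1) by (simp add: V_of_def)
      then show ?thesis
        using norm_le_norm_compatible_P[OF Q Xn_subset sub v] C(2) order_trans by blast
    qed
    then show "ODF X a Xn" unfolding ODF_def using C(1) by blast
  }
qed

end
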